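(* Let $\mu\neq\delta_0$ be a probability measure on $[0,+\infty)$ and let $t>1$ be real. Let $\mu_t$ be the probability measure on $[0,+\infty)$, $\mu_t\neq\delta_0$, characterized by $\Sigma_{\mu_t}(z)=\Sigma_\mu(z)^t$ for all $z<0$ sufficiently close to $0$. If $0\le a<b$ are both atoms of $\mu_t$ (i.e. $\mu_t(\{a\})>0$ and $\mu_t(\{b\})>0$), then $\mu_t((a,b))>0$.
   Context: Let $\Omega=\mathbb{C}\setminus[0,+\infty)$. For a probability measure $\nu\neq\delta_0$ on $[0,+\infty)$ define, for $z\in\Omega$, $\psi_\nu(z)=\int_{[0,\infty)}\frac{zs}{1-zs}\,d\nu(s)$ and $\eta_\nu(z)=\frac{\psi_\nu(z)}{1+\psi_\nu(z)}$. The function $\eta_\nu$ maps some interval $(-\alpha,0)$ injectively, and its inverse $\eta_\nu^{-1}$ is defined on a neighborhood of some interval $(-\alpha',0)$; one sets $\Sigma_\nu(z)=\eta_\nu^{-1}(z)/z$ there (the $S$-transform-type function; free multiplicative convolution satisfies $\Sigma_{\nu_1\boxtimes\nu_2}=\Sigma_{\nu_1}\Sigma_{\nu_2}$). For $z<0$ near $0$, $\Sigma_\mu(z)>0$, and $\Sigma_\mu(z)^t$ denotes the positive power. It is known (Belinschi–Bercovici) that for every $t>1$ there exists a unique probability measure $\mu_t\neq\delta_0$ on $[0,+\infty)$ with $\Sigma_{\mu_t}=\Sigma_\mu^t$ for $z<0$ near $0$; this interpolates $\mu^{\boxtimes n}$. *)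

theory Defs
  imports "HOL-Probability.Probability"
begin

definition prob_on_nonneg :: "real measure \<Rightarrow> bool" where
  "prob_on_nonneg \<nu> \<longleftrightarrow> prob_space \<nu> \<and> sets \<nu> = sets borel \<and> emeasure \<nu> {..<0} = 0"

definition not_delta0 :: "real measure \<Rightarrow> bool" where
  "not_delta0 \<nu> \<longleftrightarrow> \<nu> \<noteq> return borel 0"

definition psi :: "real measure \<Rightarrow> complex \<Rightarrow> complex" where
  "psi \<nu> z = integral\<^sup>L \<nu> (\<lambda>s. (z * complex_of_real s) / (1 - z * complex_of_real s))"

definition eta :: "real measure \<Rightarrow> complex \<Rightarrow> complex" where
  "eta \<nu> z = psi \<nu> z / (1 + psi \<nu> z)"

text \<open>Sigma_nu(z) = eta_nu^{-1}(z) / z, evaluated at real z < 0 near 0: the inverse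
  is taken on the negative real axis, where eta_nu is real-valued and injective.\<close>
definition Sigma :: "real measure \<Rightarrow> real \<Rightarrow> real" where
  "Sigma \<nu> z = (THE w::real. w < 0 \<and> eta \<nu> (complex_of_real w) = complex_of_real z) / z"

end

theory Submission
  imports Defs "HOL-Complex_Analysis.Complex_Analysis"
begin

text \<open>The explicit function \<open>\<omega>(z) = -(-\<eta>\<^sub>t(z))\<^bsup>1-1/t\<^esup> (-z)\<^bsup>1/t\<^esup>\<close>, with \<open>\<eta>\<^sub>t\<close> the eta function of \<open>\<mu>t\<close>,
  is holomorphic on the slit plane and maps it to itself. The hypothesis on Sigma says
  \<open>\<eta>\<^sub>\<mu>(\<omega>(z)) = \<eta>\<^sub>t(z)\<close> for negative \<open>z\<close> near 0, hence on the whole slit plane.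
  If \<open>\<mu>t\<close> had atoms \<open>a < b\<close> and no mass in between, \<open>\<eta>\<^sub>t\<close> would extend continuously to \<open>(1/b, 1/a)\<close>
  and take a negative value at some \<open>w\<close> there. As \<open>z\<close> tends to \<open>w\<close> from the upper half plane, the arguments of
  \<open>\<eta>\<^sub>t(z)\<close> and \<open>z\<close> tend to \<open>\<pi>\<close> and 0, so \<open>\<omega>(z)\<close> tends to a point with argument \<open>(1-1/t)\<pi>\<close>. This point lies in the
  open upper half plane, yet \<open>\<eta>\<^sub>\<mu>\<close> is real there: a contradiction.\<close>

section \<open>The slit plane and a bound for the kernel there\<close>

definition slit_plane :: "complex set" where
  "slit_plane = - (complex_of_real ` {0..})"

lemma slit_plane_iff: "z \<in> slit_plane \<longleftrightarrow> Im z \<noteq> 0 \<or> Re z < 0"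
  by (auto simp: slit_plane_def image_iff complex_eq_iff)

text \<open>Negation carries the slit to the branch cut of \<open>Ln\<close>, which makes
  \<open>Ln (- z)\<close> holomorphic here.\<close>

lemma slit_plane_iff_uminus: "z \<in> slit_plane \<longleftrightarrow> - z \<notin> \<real>\<^sub>\<le>\<^sub>0"
  by (auto simp: slit_plane_iff complex_nonpos_Reals_iff)

lemma of_real_in_slit_plane: "complex_of_real w \<in> slit_plane \<longleftrightarrow> w < 0"
  by (simp add: slit_plane_iff)

lemma slit_plane_open: "open slit_plane"
proof -
  have "slit_plane = uminus -` (- \<real>\<^sub>\<le>\<^sub>0)"
    by (auto simp: slit_plane_iff_uminus)
  moreover have "open (uminus -` (- \<real>\<^sub>\<le>\<^sub>0 :: complex set))"
    by (intro open_vimage continuous_intros) auto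
  ultimately show ?thesis by simp
qed

lemma slit_plane_connected: "connected slit_plane"
  unfolding slit_plane_def
  by (intro starlike_imp_connected starlike_slotted_complex_plane_right)

text \<open>The weight \<open>1 + s\<close> controls both 1/(1 - zs) and s/(1 - zs) uniformly in s,
  so the integrals below exist without moment assumptions.\<close>

lemma slit_plane_kernel_bound:
  assumes "z \<in> slit_plane"
  shows "\<exists>K>0. \<forall>s\<ge>0. 1 + s \<le> K * cmod (1 - z * of_real s)"
proof (cases "Im z = 0")
  case True
  then have "Re z < 0" using assms by (simp add: slit_plane_iff)
  show ?thesis
  proof (intro exI[of _ "1 + 1 / \<bar>Re z\<bar>"] conjI allI impI)
    show "0 < 1 + 1 / \<bar>Re z\<bar>" by (simp add: add_pos_nonneg)
    fix s :: real assume "0 \<le> s"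
    have n: "1 + \<bar>Re z\<bar> * s \<le> cmod (1 - z * of_real s)"
      using abs_Re_le_cmod[of "1 - z * of_real s"] \<open>Re z < 0\<close> True by simp
    have "1 + s \<le> (1 + 1 / \<bar>Re z\<bar>) * (1 + \<bar>Re z\<bar> * s)"
      using \<open>Re z < 0\<close> \<open>0 \<le> s\<close> by (simp add: field_simps mult_nonneg_nonpos mult_nonpos_nonpos)
    also have "\<dots> \<le> (1 + 1 / \<bar>Re z\<bar>) * cmod (1 - z * of_real s)"
      by (intro mult_left_mono n) auto
    finally show "1 + s \<le> (1 + 1 / \<bar>Re z\<bar>) * cmod (1 - z * of_real s)" .
  qed
next
  case False
  show ?thesis
  proof (intro exI[of _ "(cmod z + 1) / \<bar>Im z\<bar>"] conjI allI impI)
    show "0 < (cmod z + 1) / \<bar>Im z\<bar>" using False by (simp add: add_nonneg_pos)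
    fix s :: real assume "0 \<le> s"
    let ?d = "cmod (1 - z * of_real s)"
    have "\<bar>Im z\<bar> * s \<le> ?d"
      using abs_Im_le_cmod[of "1 - z * of_real s"] \<open>0 \<le> s\<close> by (simp add: abs_mult)
    \<comment> \<open>Multiplying by \<open>cnj z\<close> makes the term with s real, so the
      imaginary part is \<open>- Im z\<close> for every s.\<close>
    moreover have "\<bar>Im z\<bar> \<le> cmod z * ?d"
      using abs_Im_le_cmod[of "cnj z * (1 - z * of_real s)"]
      unfolding norm_mult by (simp add: algebra_simps)
    ultimately have "\<bar>Im z\<bar> * (1 + s) \<le> (cmod z + 1) * ?d"
      by (simp add: algebra_simps)
    then show "1 + s \<le> (cmod z + 1) / \<bar>Im z\<bar> * ?d"
      using False by (simp add: field_simps)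
  qed
qed

section \<open>Laws other than the point mass at 0\<close>

locale nontrivial_law = prob_space \<nu> for \<nu> :: "real measure" +
  assumes sets_borel [measurable_cong]: "sets \<nu> = sets borel"
    and AE_nonneg: "AE s in \<nu>. 0 \<le> s"
    and not_dirac: "\<nu> \<noteq> return borel 0"

lemma nontrivial_lawI:
  assumes "prob_on_nonneg \<nu>" "not_delta0 \<nu>"
  shows "nontrivial_law \<nu>"
proof -
  interpret prob_space \<nu> using assms by (simp add: prob_on_nonneg_def)
  have *: "sets \<nu> = sets borel" "emeasure \<nu> {..<0} = 0"
    using assms by (auto simp: prob_on_nonneg_def)
  have "AE s in \<nu>. 0 \<le> s"
    by (rule AE_I[of _ _ "{..<0}"]) (auto simp: *)
  then show ?thesis
    using assms * by unfold_locales (auto simp: not_delta0_def)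
qed

context nontrivial_law
begin

text \<open>A zero integral would force s = 0 almost everywhere, hence the point mass at 0. The
  integrand may vanish at 0, as kernels with a factor s do.\<close>

lemma integral_pos:
  fixes f :: "real \<Rightarrow> real"
  assumes "integrable \<nu> f" "\<And>s. s \<ge> 0 \<Longrightarrow> f s \<ge> 0" "\<And>s. s > 0 \<Longrightarrow> f s > 0"
  shows "0 < integral\<^sup>L \<nu> f"
proof -
  have nn: "AE s in \<nu>. 0 \<le> f s"
    using AE_nonneg by eventually_elim (rule assms(2))
  have "integral\<^sup>L \<nu> f \<noteq> 0"
  proof
    assume "integral\<^sup>L \<nu> f = 0"
    then have "AE s in \<nu>. f s = 0"
      using integral_nonneg_eq_0_iff_AE[OF assms(1) nn] by simp
    with AE_nonneg have ae: "AE s in \<nu>. s = 0"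
    proof eventually_elim
      case (elim s)
      then show "s = 0" using assms(3)[of s] by argo
    qed
    have "\<nu> = return borel 0"
    proof (rule measure_eqI)
      fix A assume A: "A \<in> sets \<nu>"
      have "emeasure \<nu> A = (\<integral>\<^sup>+s. indicator A s \<partial>\<nu>)" using A by simp
      also have "\<dots> = (\<integral>\<^sup>+s. indicator A 0 \<partial>\<nu>)"
      proof (rule nn_integral_cong_AE)
        show "AE s in \<nu>. indicator A s = (indicator A 0 :: ennreal)"
          using ae by eventually_elim simp
      qed
      also have "\<dots> = indicator A 0" by (simp add: emeasure_space_1)
      finally show "emeasure \<nu> A = emeasure (return borel 0) A"
        using A by (simp add: sets_borel)
    qed (simp add: sets_borel)
    then show False using not_dirac by simp
  qed
  moreover have "0 \<le> integral\<^sup>L \<nu> f" using nn by (rule integral_nonneg_AE)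
  ultimately show ?thesis by simp
qed

section \<open>Points where psi is differentiable\<close>

text \<open>A quantitative form of 1/z lying off the support. Being an almost-everywhere condition,
  it covers the slit plane and also positive reals whose reciprocal lies in a gap.\<close>

definition admissible :: "real \<Rightarrow> complex \<Rightarrow> bool" where
  "admissible K z \<longleftrightarrow> K > 0 \<and> (AE s in \<nu>. 1 + s \<le> K * cmod (1 - z * of_real s))"

lemma slit_plane_admissible:
  assumes "z \<in> slit_plane" shows "\<exists>K. admissible K z"
proof -
  obtain K where "K > 0" "\<forall>s\<ge>0. 1 + s \<le> K * cmod (1 - z * of_real s)"
    using slit_plane_kernel_bound[OF assms] by blast
  with AE_nonneg have "admissible K z"
    unfolding admissible_def by (auto elim: eventually_mono)
  then show ?thesis ..
qed

text \<open>Moving z by less than 1/(2K) changes K|1 - zs| by at most s/2, which half of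
  \<open>1 + s\<close> absorbs. The constant \<open>2 * K\<close> is uniform near z, as domination
  requires.\<close>

lemma admissible_nearby:
  assumes "admissible K z" "dist y z < 1 / (2 * K)"
  shows "admissible (2 * K) y"
proof -
  have K: "K > 0" using assms(1) by (simp add: admissible_def)
  have "AE s in \<nu>. 1 + s \<le> K * cmod (1 - z * of_real s)"
    using assms(1) by (simp add: admissible_def)
  then have "AE s in \<nu>. 1 + s \<le> 2 * K * cmod (1 - y * of_real s)"
    using AE_nonneg
  proof eventually_elim
    fix s :: real assume s: "1 + s \<le> K * cmod (1 - z * of_real s)" "0 \<le> s"
    have "cmod (1 - z * of_real s) \<le> cmod (1 - y * of_real s) + cmod ((y - z) * of_real s)"
      using norm_triangle_ineq[of "1 - y * of_real s" "(y - z) * of_real s"]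
      by (simp add: algebra_simps)
    also have "cmod ((y - z) * of_real s) \<le> 1 / (2 * K) * s"
      unfolding norm_mult using assms(2) s K by (intro mult_mono) (auto simp: dist_norm)
    finally have "K * cmod (1 - z * of_real s) \<le> K * cmod (1 - y * of_real s) + s / 2"
      using K by (simp add: field_simps)
    then show "1 + s \<le> 2 * K * cmod (1 - y * of_real s)" using s by simp
  qed
  then show ?thesis using K by (simp add: admissible_def)
qed

lemma admissible_nonzero:
  assumes "admissible K z"
  shows "AE s in \<nu>. 1 - z * of_real s \<noteq> 0"
proof -
  have "AE s in \<nu>. 1 + s \<le> K * cmod (1 - z * of_real s)"
    using assms by (simp add: admissible_def)
  then show ?thesis using AE_nonneg by eventually_elim auto
qed

lemma integrable_psi_kernel:
  assumes "admissible K z"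
  shows "integrable \<nu> (\<lambda>s. z * of_real s / (1 - z * of_real s))"
proof (rule integrable_const_bound)
  have K: "K > 0" using assms by (simp add: admissible_def)
  have "AE s in \<nu>. 1 + s \<le> K * cmod (1 - z * of_real s)"
    using assms by (simp add: admissible_def)
  then show "AE s in \<nu>. cmod (z * of_real s / (1 - z * of_real s)) \<le> K * cmod z"
    using AE_nonneg admissible_nonzero[OF assms]
  proof eventually_elim
    fix s :: real
    assume s: "1 + s \<le> K * cmod (1 - z * of_real s)" "0 \<le> s" "1 - z * of_real s \<noteq> 0"
    have "cmod z * s \<le> cmod z * (K * cmod (1 - z * of_real s))"
      using s by (intro mult_left_mono) auto
    then show "cmod (z * of_real s / (1 - z * of_real s)) \<le> K * cmod z"
      using s by (simp add: norm_divide norm_mult divide_le_eq mult_ac)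
  qed
qed measurable

text \<open>The difference quotient is itself an integral, with integrand \<open>?g\<close>. Near z
  it is dominated by a constant, so dominated convergence gives the derivative.\<close>

lemma psi_has_field_derivative:
  assumes "admissible K z"
  shows "(psi \<nu> has_field_derivative (\<integral>s. of_real s / (1 - z * of_real s)^2 \<partial>\<nu>)) (at z)"
proof -
  have K: "K > 0" using assms by (simp add: admissible_def)
  define B where "B = ball z (1 / (2 * K))"
  have zB: "z \<in> B" "open B" using K by (auto simp: B_def)
  have adm: "admissible (2 * K) y" if "y \<in> B" for y
    using admissible_nearby[OF assms, of y] that by (simp add: B_def dist_commute)
  let ?g = "\<lambda>y s. complex_of_real s / ((1 - y * of_real s) * (1 - z * of_real s))"
  have quot: "(psi \<nu> y - psi \<nu> z) / (y - z) = (\<integral>s. ?g y s \<partial>\<nu>)" if y: "y \<in> B - {z}" for y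
  proof -
    have "psi \<nu> y - psi \<nu> z = (\<integral>s. y * of_real s / (1 - y * of_real s) - z * of_real s / (1 - z * of_real s) \<partial>\<nu>)"
      unfolding psi_def using integrable_psi_kernel[OF adm] integrable_psi_kernel[OF assms] y
      by (subst Bochner_Integration.integral_diff) auto
    also have "\<dots> = (\<integral>s. (y - z) * ?g y s \<partial>\<nu>)"
    proof (rule integral_cong_AE)
      show "AE s in \<nu>. y * of_real s / (1 - y * of_real s) - z * of_real s / (1 - z * of_real s) = (y - z) * ?g y s"
        using admissible_nonzero[OF adm, of y] admissible_nonzero[OF assms] y
        by (auto elim!: eventually_elim2 simp: diff_frac_eq) (simp add: algebra_simps)
    qed measurable
    also have "\<dots> = (y - z) * (\<integral>s. ?g y s \<partial>\<nu>)"
      by (rule Bochner_Integration.integral_mult_right_zero)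
    finally show ?thesis using y by simp
  qed
  have "((\<lambda>y. (psi \<nu> y - psi \<nu> z) / (y - z)) \<longlongrightarrow> (\<integral>s. of_real s / (1 - z * of_real s)^2 \<partial>\<nu>)) (at z within B)"
    unfolding tendsto_at_iff_sequentially comp_def
  proof (intro allI impI)
    fix X :: "nat \<Rightarrow> complex"
    assume X: "\<forall>i. X i \<in> B - {z}" and lim: "X \<longlonglongrightarrow> z"
    have "(\<lambda>i. \<integral>s. ?g (X i) s \<partial>\<nu>) \<longlonglongrightarrow> (\<integral>s. of_real s / (1 - z * of_real s)^2 \<partial>\<nu>)"
    proof (rule integral_dominated_convergence[where w = "\<lambda>_. 2 * K * K"])
      show "AE s in \<nu>. (\<lambda>i. ?g (X i) s) \<longlonglongrightarrow> of_real s / (1 - z * of_real s)^2"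
        using admissible_nonzero[OF assms]
      proof eventually_elim
        case (elim s)
        then show ?case unfolding power2_eq_square
          by (intro tendsto_intros lim) auto
      qed
      show "AE s in \<nu>. cmod (?g (X i) s) \<le> 2 * K * K" for i
      proof -
        have "admissible (2 * K) (X i)" using X adm by auto
        then have "AE s in \<nu>. 1 + s \<le> 2 * K * cmod (1 - X i * of_real s)"
          "AE s in \<nu>. 1 + s \<le> K * cmod (1 - z * of_real s)"
          using assms by (simp_all add: admissible_def)
        then show ?thesis using AE_nonneg
        proof eventually_elim
          fix s :: real
          assume s: "1 + s \<le> 2 * K * cmod (1 - X i * of_real s)"
            "1 + s \<le> K * cmod (1 - z * of_real s)" "0 \<le> s"
          let ?p = "cmod (1 - X i * of_real s)" and ?q = "cmod (1 - z * of_real s)"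
          have pq: "?p > 0" "?q > 0" using s K by (auto intro!: Nat.gr0I)
          \<comment> \<open>One factor \<open>1 + s\<close> is spent on each of the two
            denominators.\<close>
          have "s \<le> (1 + s) * (1 + s)" using s by (simp add: algebra_simps)
          also have "\<dots> \<le> (2 * K * ?p) * (K * ?q)" using s K by (intro mult_mono) auto
          finally show "cmod (?g (X i) s) \<le> 2 * K * K"
            using pq s by (simp add: norm_divide norm_mult divide_le_eq mult_ac)
        qed
      qed
    qed simp_all
    then show "(\<lambda>i. (psi \<nu> (X i) - psi \<nu> z) / (X i - z)) \<longlonglongrightarrow> (\<integral>s. of_real s / (1 - z * of_real s)^2 \<partial>\<nu>)"
      using quot X by simp
  qed
  then show ?thesis
    unfolding has_field_derivative_iff at_within_open[OF zB] .
qed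

section \<open>The imaginary part of psi\<close>

lemma Im_psi_kernel:
  "Im (z * of_real s / (1 - z * of_real s)) = Im z * (s / (cmod (1 - z * of_real s))^2)"
  by (simp add: Im_divide cmod_power2 algebra_simps)

lemma Im_psi:
  assumes "admissible K z"
  shows "Im (psi \<nu> z) = Im z * (\<integral>s. s / (cmod (1 - z * of_real s))^2 \<partial>\<nu>)"
proof -
  have "Im (psi \<nu> z) = (\<integral>s. Im (z * of_real s / (1 - z * of_real s)) \<partial>\<nu>)"
    unfolding psi_def using integrable_psi_kernel[OF assms] by simp
  also have "\<dots> = (\<integral>s. Im z * (s / (cmod (1 - z * of_real s))^2) \<partial>\<nu>)"
    by (simp only: Im_psi_kernel)
  also have "\<dots> = Im z * (\<integral>s. s / (cmod (1 - z * of_real s))^2 \<partial>\<nu>)"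
    by (rule Bochner_Integration.integral_mult_right_zero)
  finally show ?thesis .
qed

text \<open>The kernel's imaginary part is \<open>Im z\<close> times a weight that is positive for s
  > 0. The factor c treats both half planes at once.\<close>

lemma Im_psi_sign:
  assumes "Im z \<noteq> 0"
  shows "\<exists>c>0. Im (psi \<nu> z) = c * Im z"
proof -
  have nz: "1 - z * of_real s \<noteq> 0" for s
    using assms by (cases "s = 0") (auto simp: complex_eq_iff)
  obtain K where K: "admissible K z"
    using slit_plane_admissible assms by (auto simp: slit_plane_iff)
  have "integrable \<nu> (\<lambda>s. Im (z * of_real s / (1 - z * of_real s)) / Im z)"
    using integrable_psi_kernel[OF K] by simp
  also have "(\<lambda>s. Im (z * of_real s / (1 - z * of_real s)) / Im z) = (\<lambda>s. s / (cmod (1 - z * of_real s))^2)"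
    using assms by (simp only: Im_psi_kernel) simp
  finally have "0 < (\<integral>s. s / (cmod (1 - z * of_real s))^2 \<partial>\<nu>)"
    by (rule integral_pos) (use nz in auto)
  then show ?thesis using Im_psi[OF K] by (auto simp: mult.commute)
qed

section \<open>Psi on the real axis\<close>

definition psi_real :: "real \<Rightarrow> real" where
  "psi_real w = (\<integral>s. w * s / (1 - w * s) \<partial>\<nu>)"

lemma psi_of_real: "psi \<nu> (of_real w) = of_real (psi_real w)"
  unfolding psi_def psi_real_def
  by (subst integral_complex_of_real[symmetric]) simp

lemma integrable_psi_real_kernel:
  assumes "admissible K (of_real w)"
  shows "integrable \<nu> (\<lambda>s. w * s / (1 - w * s))"
proof -
  have "of_real w * of_real s / (1 - of_real w * of_real s) = complex_of_real (w * s / (1 - w * s))" for s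
    by simp
  then have "integrable \<nu> (\<lambda>s. complex_of_real (w * s / (1 - w * s)))"
    using integrable_psi_kernel[OF assms] by (simp only:)
  then have "integrable \<nu> (\<lambda>s. Re (complex_of_real (w * s / (1 - w * s))))"
    by (rule integrable_Re)
  then show ?thesis by (simp only: Re_complex_of_real)
qed

lemma one_plus_psi_real:
  assumes "admissible K (of_real w)"
  shows "integrable \<nu> (\<lambda>s. 1 / (1 - w * s))" "1 + psi_real w = (\<integral>s. 1 / (1 - w * s) \<partial>\<nu>)"
proof -
  note int = integrable_psi_real_kernel[OF assms]
  \<comment> \<open>Where \<open>1 - w * s = 0\<close>, division by zero makes the left side 1 and
    the right side 0, so the identity is only claimed almost everywhere.\<close>
  have nz: "AE s in \<nu>. 1 + w * s / (1 - w * s) = 1 / (1 - w * s)"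
    using admissible_nonzero[OF assms]
  proof eventually_elim
    case (elim s)
    then have "1 - w * s \<noteq> 0"
      by (metis of_real_0 of_real_1 of_real_diff of_real_mult)
    then show ?case by (simp add: field_simps)
  qed
  have int1: "integrable \<nu> (\<lambda>s. 1 + w * s / (1 - w * s))" using int by simp
  then show "integrable \<nu> (\<lambda>s. 1 / (1 - w * s))"
    by (rule integrable_cong_AE_imp) (use nz in \<open>auto elim: eventually_mono\<close>)
  have "1 + psi_real w = (\<integral>s. 1 + w * s / (1 - w * s) \<partial>\<nu>)"
    unfolding psi_real_def using int by (simp add: prob_space)
  also have "\<dots> = (\<integral>s. 1 / (1 - w * s) \<partial>\<nu>)"
    by (rule integral_cong_AE) (use nz in auto)
  finally show "1 + psi_real w = (\<integral>s. 1 / (1 - w * s) \<partial>\<nu>)" .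
qed

lemma psi_real_neg:
  assumes "w < 0"
  shows "psi_real w < 0" "1 + psi_real w > 0"
proof -
  obtain K where K: "admissible K (of_real w)"
    using slit_plane_admissible assms by (meson of_real_in_slit_plane)
  have pos: "1 - w * s > 0" if "s \<ge> 0" for s
    using assms that by (smt (verit) mult_nonpos_nonneg)
  have "0 < (\<integral>s. - (w * s / (1 - w * s)) \<partial>\<nu>)"
    using integrable_psi_real_kernel[OF K] assms pos
    by (intro integral_pos)
       (auto simp: divide_nonpos_pos divide_neg_pos mult_nonpos_nonneg mult_neg_pos simp del: integral_minus)
  then show "psi_real w < 0" by (simp add: psi_real_def)
  have "0 < (\<integral>s. 1 / (1 - w * s) \<partial>\<nu>)"
    using one_plus_psi_real(1)[OF K] pos by (intro integral_pos) (auto intro: less_imp_le)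
  then show "1 + psi_real w > 0" using one_plus_psi_real(2)[OF K] by simp
qed

lemma psi_real_strict_mono:
  assumes "v < w" "w < 0"
  shows "psi_real v < psi_real w"
proof -
  obtain K L where K: "admissible K (of_real v)" "admissible L (of_real w)"
    using slit_plane_admissible assms by (meson less_trans of_real_in_slit_plane)
  have pos: "1 - u * s > 0" if "s \<ge> 0" "u < 0" for u s :: real
    using that by (smt (verit) mult_nonpos_nonneg)
  have "w * s / (1 - w * s) - v * s / (1 - v * s) = (w - v) * s / ((1 - w * s) * (1 - v * s))"
    if "s \<ge> 0" for s
    using pos[OF that, of w] pos[OF that, of v] assms by (simp add: diff_frac_eq) (simp add: algebra_simps)
  then have "0 < (\<integral>s. w * s / (1 - w * s) - v * s / (1 - v * s) \<partial>\<nu>)"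
    using K[THEN integrable_psi_real_kernel] pos assms
    by (intro integral_pos) (auto simp: divide_nonneg_pos intro!: divide_nonneg_pos divide_pos_pos mult_pos_pos)
  then show ?thesis
    using K[THEN integrable_psi_real_kernel] by (simp add: psi_real_def)
qed

text \<open>For negative arguments the kernel is bounded by 1, so dominated convergence needs no
  finite mean.\<close>

lemma psi_real_tendsto_0: "(psi_real \<longlongrightarrow> 0) (at_left 0)"
  unfolding tendsto_at_iff_sequentially comp_def
proof (intro allI impI)
  fix X :: "nat \<Rightarrow> real"
  assume X: "\<forall>i. X i \<in> {..<0} - {0}" and lim: "X \<longlonglongrightarrow> 0"
  have "(\<lambda>i. \<integral>s. X i * s / (1 - X i * s) \<partial>\<nu>) \<longlonglongrightarrow> (\<integral>s. 0 \<partial>\<nu>)"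
  proof (rule integral_dominated_convergence[where w = "\<lambda>_. 1"])
    show "AE s in \<nu>. (\<lambda>i. X i * s / (1 - X i * s)) \<longlonglongrightarrow> 0"
    proof (rule AE_I2)
      fix s
      have "(\<lambda>i. X i * s / (1 - X i * s)) \<longlonglongrightarrow> 0 * s / (1 - 0 * s)"
        by (intro tendsto_intros lim) simp
      then show "(\<lambda>i. X i * s / (1 - X i * s)) \<longlonglongrightarrow> 0" by simp
    qed
    show "AE s in \<nu>. norm (X i * s / (1 - X i * s)) \<le> 1" for i
      using AE_nonneg
    proof eventually_elim
      case (elim s)
      have "X i < 0" using X by auto
      then have "X i * s \<le> 0" using elim by (intro mult_nonpos_nonneg) auto
      then show ?case by (simp add: divide_le_eq le_divide_eq)
    qed
  qed simp_all
  then show "(\<lambda>i. psi_real (X i)) \<longlonglongrightarrow> 0" by (simp add: psi_real_def)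
qed

section \<open>Eta on the slit plane and its inverse on the negative axis\<close>

lemma one_plus_psi_nonzero:
  assumes "z \<in> slit_plane"
  shows "1 + psi \<nu> z \<noteq> 0"
proof (cases "Im z = 0")
  case True
  then have "z = of_real (Re z)" "Re z < 0"
    using assms by (auto simp: slit_plane_iff complex_eq_iff)
  then show ?thesis
    using psi_real_neg(2)[of "Re z"] psi_of_real[of "Re z"]
    by (metis less_irrefl of_real_1 of_real_add of_real_eq_0_iff)
next
  case False
  then have "Im (psi \<nu> z) \<noteq> 0" using Im_psi_sign[OF False] by auto
  then show ?thesis by (auto simp: complex_eq_iff)
qed

lemma eta_holomorphic: "eta \<nu> holomorphic_on slit_plane"
proof -
  have "psi \<nu> holomorphic_on slit_plane"
    unfolding holomorphic_on_def
    using slit_plane_admissible psi_has_field_derivative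
    by (meson field_differentiable_at_within field_differentiable_def)
  then show ?thesis
    unfolding eta_def using one_plus_psi_nonzero by (intro holomorphic_intros) auto
qed

definition eta_real :: "real \<Rightarrow> real" where
  "eta_real w = psi_real w / (1 + psi_real w)"

lemma eta_of_real: "eta \<nu> (of_real w) = of_real (eta_real w)"
  by (simp add: eta_def eta_real_def psi_of_real)

lemma eta_real_neg: "w < 0 \<Longrightarrow> eta_real w < 0"
  using psi_real_neg[of w] by (simp add: eta_real_def divide_neg_pos)

text \<open>Im (p/(1 + p)) = Im p/|1 + p|^2. In particular eta is never real off the real axis,
  which yields the final contradiction.\<close>

lemma Im_eta_sign:
  assumes "Im z \<noteq> 0"
  shows "\<exists>c>0. Im (eta \<nu> z) = c * Im z"
proof -
  obtain c where c: "c > 0" "Im (psi \<nu> z) = c * Im z" using Im_psi_sign[OF assms] by blast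
  have nz: "1 + psi \<nu> z \<noteq> 0" by (rule one_plus_psi_nonzero) (simp add: slit_plane_iff assms)
  have "Im (eta \<nu> z) = Im (psi \<nu> z) / (cmod (1 + psi \<nu> z))^2"
    unfolding eta_def by (simp add: Im_divide cmod_power2 algebra_simps)
  then have "Im (eta \<nu> z) = c / (cmod (1 + psi \<nu> z))^2 * Im z" using c by simp
  moreover have "c / (cmod (1 + psi \<nu> z))^2 > 0" using c nz by simp
  ultimately show ?thesis by blast
qed

lemma eta_in_slit_plane:
  assumes "z \<in> slit_plane" shows "eta \<nu> z \<in> slit_plane"
proof (cases "Im z = 0")
  case True
  then have "z = of_real (Re z)" "Re z < 0"
    using assms by (auto simp: slit_plane_iff complex_eq_iff)
  then show ?thesis using eta_real_neg eta_of_real of_real_in_slit_plane by metis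
next
  case False
  then show ?thesis using Im_eta_sign[OF False] by (auto simp: slit_plane_iff)
qed

lemma eta_real_strict_mono:
  assumes "v < w" "w < 0"
  shows "eta_real v < eta_real w"
  using psi_real_strict_mono[OF assms] psi_real_neg[of v] psi_real_neg[of w] assms
  unfolding eta_real_def by (simp add: frac_less_eq divide_less_eq less_divide_eq field_simps)

lemma eta_real_tendsto_0: "(eta_real \<longlongrightarrow> 0) (at_left 0)"
proof -
  have "(eta_real \<longlongrightarrow> 0 / (1 + 0)) (at_left 0)"
    unfolding eta_real_def by (intro tendsto_intros psi_real_tendsto_0) simp
  then show ?thesis by simp
qed

lemma continuous_on_eta_real: "continuous_on {..<0} eta_real"
proof -
  have "continuous_on {..<0} (\<lambda>w. Re (eta \<nu> (of_real w)))"
    by (intro continuous_intros continuous_on_compose2[OF holomorphic_on_imp_continuous_on[OF eta_holomorphic]])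
       (auto simp: of_real_in_slit_plane)
  then show ?thesis by (simp add: eta_of_real)
qed

text \<open>Intermediate values between -1 and a point close to 0. The start -1 is arbitrary: any
  left neighborhood of 0 in the range suffices.\<close>

lemma eta_real_surj_near_0:
  assumes "eta_real (- 1) < x" "x < 0"
  shows "\<exists>w<0. eta_real w = x"
proof -
  have "eventually (\<lambda>w. x < eta_real w \<and> -1 < w \<and> w < 0) (at_left 0)"
    using order_tendstoD(1)[OF eta_real_tendsto_0 assms(2)]
      eventually_at_left_real[of "-1" "0::real", simplified] by eventually_elim auto
  then obtain v where v: "x < eta_real v" "-1 < v" "v < 0"
    using eventually_happens[of _ "at_left (0::real)"] by auto
  have "\<exists>w\<ge>-1. w \<le> v \<and> eta_real w = x"
    by (rule IVT') (use v assms in \<open>auto intro: continuous_on_subset[OF continuous_on_eta_real]\<close>)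
  then show ?thesis using v by (metis order_le_less_trans)
qed

text \<open>Strict monotonicity gives the description in \<open>Sigma\<close> a unique solution, so
  \<open>Sigma\<close> can be handled through the parameter w.\<close>

lemma Sigma_eta_real:
  assumes "w < 0"
  shows "Sigma \<nu> (eta_real w) = w / eta_real w"
proof -
  have "(THE v. v < 0 \<and> eta \<nu> (of_real v) = of_real (eta_real w)) = w"
    using assms eta_real_strict_mono by (intro the_equality) (auto simp: eta_of_real, metis less_irrefl neqE)
  then show ?thesis by (simp add: Sigma_def)
qed

section \<open>Psi and eta at reciprocals of points in a gap of the support\<close>

text \<open>The ratio (1 + s)/|1 - ws| increases up to a and decreases from b on. The two summands
  are its values at a and b, and their sum serves both sides.\<close>

lemma admissible_gap:
  assumes gap: "AE s in \<nu>. s \<le> a \<or> b \<le> s" and "0 \<le> a" "0 < w" "1 < w * b" "w * a < 1"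
  shows "admissible ((1 + a) / (1 - w * a) + (1 + b) / (w * b - 1)) (of_real w)"
proof -
  define K L where "K = (1 + a) / (1 - w * a)" and "L = (1 + b) / (w * b - 1)"
  have "b > 0" using assms by (smt (verit) zero_less_mult_pos)
  then have KL: "K > 0" "L > 0" using assms by (simp_all add: K_def L_def)
  have "AE s in \<nu>. 1 + s \<le> (K + L) * cmod (1 - of_real w * of_real s)"
    using gap AE_nonneg
  proof eventually_elim
    case (elim s)
    have n: "cmod (1 - of_real w * of_real s) = \<bar>1 - w * s\<bar>"
      by (metis norm_of_real of_real_1 of_real_diff of_real_mult)
    show ?case
    proof (cases "s \<le> a")
      case True
      then have "w * s \<le> w * a" using assms by (intro mult_left_mono) auto
      then have "1 - w * a \<le> \<bar>1 - w * s\<bar>" by linarith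
      have "1 + s \<le> K * (1 - w * a)" using True assms by (simp add: K_def)
      also have "\<dots> \<le> (K + L) * \<bar>1 - w * s\<bar>"
        using KL assms \<open>1 - w * a \<le> \<bar>1 - w * s\<bar>\<close> by (intro mult_mono) auto
      finally show ?thesis by (simp add: n)
    next
      case False
      then have "s \<ge> b" using elim by auto
      then have ws: "w * s \<ge> w * b" using assms by (intro mult_left_mono) auto
      then have ws1: "0 < w * s - 1" using assms by linarith
      have "(1 + s) * (w * b - 1) \<le> (1 + b) * (w * s - 1)"
        using \<open>s \<ge> b\<close> ws by (simp add: algebra_simps)
      then have "1 + s \<le> L * (w * s - 1)"
        using assms by (simp add: L_def field_simps)
      also have "\<dots> \<le> (K + L) * \<bar>1 - w * s\<bar>"
        using KL ws1 by (intro mult_mono) auto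
      finally show ?thesis by (simp add: n)
    qed
  qed
  then show ?thesis using KL by (simp add: admissible_def K_def L_def)
qed

lemma isCont_psi: "admissible K z \<Longrightarrow> isCont (psi \<nu>) z"
  using psi_has_field_derivative by (rule DERIV_isCont)

text \<open>The kernel 1/(1 - ws) lies in (0, 1/(1 - wa)] left of the gap and in [-1/(wb - 1), 0)
  right of it. Each bound keeps the term of one atom, which dominates when w is near the
  corresponding end.\<close>

lemma psi_real_gap_bounds:
  assumes gap: "AE s in \<nu>. s \<le> a \<or> b \<le> s" and "0 \<le> a" "0 < w" "1 < w * b" "w * a < 1"
  shows "1 + psi_real w \<le> 1 / (1 - w * a) - prob {b} / (w * b - 1)"
    and "prob {a} / (1 - w * a) - 1 / (w * b - 1) \<le> 1 + psi_real w"
proof -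
  note F = one_plus_psi_real[OF admissible_gap[OF assms]]
  have "a < b" using assms by (smt (verit) mult_left_mono)
  have left: "0 < 1 / (1 - w * s) \<and> 1 / (1 - w * s) \<le> 1 / (1 - w * a)" if "s \<le> a" for s
  proof -
    have "w * s \<le> w * a" using that assms by (intro mult_left_mono) auto
    then have "0 < 1 - w * a" "1 - w * a \<le> 1 - w * s" using assms by linarith+
    then show ?thesis by (auto intro!: divide_left_mono mult_pos_pos simp only: zero_less_divide_1_iff)
  qed
  have right: "1 / (1 - w * s) < 0 \<and> - 1 / (w * b - 1) \<le> 1 / (1 - w * s)" if "b \<le> s" for s
  proof -
    have "w * b \<le> w * s" using that assms by (intro mult_left_mono) auto
    then have "0 < w * b - 1" "w * b - 1 \<le> w * s - 1" using assms by linarith+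
    then have "0 < 1 / (w * s - 1)" "1 / (w * s - 1) \<le> 1 / (w * b - 1)"
      by (auto intro!: divide_left_mono mult_pos_pos simp only: zero_less_divide_1_iff)
    moreover have "1 / (1 - w * s) = - (1 / (w * s - 1))"
      by (metis minus_diff_eq minus_divide_right)
    ultimately show ?thesis by simp
  qed
  have int: "integrable \<nu> (\<lambda>s. indicator {x} s / c)" for x c :: real
    by (intro integrable_divide integrable_real_indicator) (auto simp: sets_borel less_top[symmetric])
  have "1 + psi_real w \<le> (\<integral>s. 1 / (1 - w * a) - indicator {b} s / (w * b - 1) \<partial>\<nu>)"
    unfolding F(2)
  proof (rule integral_mono_AE[OF F(1)])
    show "AE s in \<nu>. 1 / (1 - w * s) \<le> 1 / (1 - w * a) - indicator {b} s / (w * b - 1)"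
      using gap
    proof eventually_elim
      case (elim s)
      have "1 / (1 - w * b) = - 1 / (w * b - 1)" using assms by (simp add: field_simps)
      then show ?case
        using elim left[of s] right[of s] left[of a] \<open>a < b\<close>
        by (cases "s = b"; simp add: indicator_def; linarith)
    qed
    show "integrable \<nu> (\<lambda>s. 1 / (1 - w * a) - indicator {b} s / (w * b - 1))"
      by (intro Bochner_Integration.integrable_diff integrable_const int)
  qed
  then show "1 + psi_real w \<le> 1 / (1 - w * a) - prob {b} / (w * b - 1)"
    by (subst (asm) Bochner_Integration.integral_diff[OF integrable_const int])
       (simp add: sets_borel prob_space)
  have "(\<integral>s. indicator {a} s / (1 - w * a) - 1 / (w * b - 1) \<partial>\<nu>) \<le> 1 + psi_real w"
    unfolding F(2)
  proof (rule integral_mono_AE[OF _ F(1)])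
    show "AE s in \<nu>. indicator {a} s / (1 - w * a) - 1 / (w * b - 1) \<le> 1 / (1 - w * s)"
      using gap
    proof eventually_elim
      case (elim s)
      have pos: "0 < 1 / (w * b - 1)" using assms by simp
      show ?case
      proof (cases "s = a")
        case True
        then show ?thesis using assms by simp
      next
        case False
        have "- (1 / (w * b - 1)) \<le> 1 / (1 - w * s)"
          using elim left[of s] right[of s] pos by (metis less_eq_real_def less_trans minus_divide_left neg_less_0_iff_less)
        then show ?thesis using False by simp
      qed
    qed
    show "integrable \<nu> (\<lambda>s. indicator {a} s / (1 - w * a) - 1 / (w * b - 1))"
      by (intro Bochner_Integration.integrable_diff integrable_const int)
  qed
  then show "prob {a} / (1 - w * a) - 1 / (w * b - 1) \<le> 1 + psi_real w"
    by (subst (asm) Bochner_Integration.integral_diff[OF int integrable_const])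
       (simp add: sets_borel prob_space)
qed

text \<open>Near \<open>1/b\<close> the atom at \<open>b\<close> makes \<open>1 + psi\<close> negative, towards \<open>1/a\<close> the atom at \<open>a\<close> makes it
  positive (also for \<open>a = 0\<close>, where \<open>1/a\<close> means infinity); in between \<open>0 < 1 + psi < 1\<close> occurs.\<close>

lemma eta_real_neg_in_gap:
  assumes gap: "AE s in \<nu>. s \<le> a \<or> b \<le> s" and ab: "0 \<le> a" "a < b"
    and atoms: "prob {a} > 0" "prob {b} > 0"
  shows "\<exists>w K. w > 0 \<and> admissible K (of_real w) \<and> eta_real w < 0"
proof -
  \<comment> \<open>This is the interval (1/b, 1/a); the products avoid 1/a, so a = 0 gives the ray
    beyond 1/b.\<close>
  define G where "G = {w. 0 < w \<and> 1 < w * b \<and> w * a < 1}"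
  have G: "\<exists>K. admissible K (of_real w)" if "w \<in> G" for w
    using admissible_gap[OF gap ab(1), of w] that by (auto simp: G_def)
  have cont: "continuous_on G psi_real"
  proof (rule continuous_at_imp_continuous_on, intro ballI)
    fix w assume "w \<in> G"
    then have "isCont (psi \<nu>) (of_real w)" using G isCont_psi by blast
    then have "isCont (\<lambda>w. Re (psi \<nu> (of_real w))) w"
      by (intro isCont_Re isCont_o2[where g = "psi \<nu>" and f = of_real] isCont_of_real) auto
    then show "isCont psi_real w" by (simp add: psi_of_real)
  qed
  define m n where "m = prob {a} / 2" and "n = prob {b} / 2"
  have mn: "m > 0" "n > 0" "prob {a} = 2 * m" "prob {b} = 2 * n"
    using atoms by (auto simp: m_def n_def)
  \<comment> \<open>These solve \<open>u * b - 1 = n * (1 - u * a)\<close> and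
    \<open>1 - v * a = m * (v * b - 1)\<close>. With m and n half the masses, the atom's term is
    then exactly twice the opposing one.\<close>
  define u v where "u = (1 + n) / (b + n * a)" and "v = (1 + m) / (m * b + a)"
  have pos: "b + n * a > 0" "m * b + a > 0"
    using ab mn by (auto intro!: add_pos_nonneg)
  have u1: "1 - u * a = (b - a) / (b + n * a)" "u * b - 1 = n * (b - a) / (b + n * a)"
    using pos by (auto simp: u_def field_simps)
  have v1: "1 - v * a = m * (b - a) / (m * b + a)" "v * b - 1 = (b - a) / (m * b + a)"
    using pos by (auto simp: v_def field_simps)
  have "0 < 1 - u * a" "0 < u * b - 1" "0 < 1 - v * a" "0 < v * b - 1"
    unfolding u1 v1 using pos mn ab by simp_all
  moreover have "0 < u" "0 < v" using pos mn by (auto simp: u_def v_def)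
  ultimately have uvG: "u \<in> G" "v \<in> G" by (auto simp: G_def)
  have "1 + psi_real u \<le> 1 / (1 - u * a) - prob {b} / (u * b - 1)"
    using psi_real_gap_bounds(1)[OF gap ab(1), of u] uvG by (simp add: G_def)
  also have "\<dots> = - ((b + n * a) / (b - a))"
  proof -
    have "2 * n / (n * (b - a) / (b + n * a)) = 2 * ((b + n * a) / (b - a))"
      using mn by simp
    then show ?thesis unfolding u1 mn by simp
  qed
  also have "\<dots> < 0" using ab pos by simp
  finally have u0: "1 + psi_real u < 0" .
  have "0 < (m * b + a) / (b - a)" using ab pos by simp
  also have "\<dots> = prob {a} / (1 - v * a) - 1 / (v * b - 1)"
  proof -
    have "2 * m / (m * (b - a) / (m * b + a)) = 2 * ((m * b + a) / (b - a))"
      using mn by simp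
    then show ?thesis unfolding v1 mn by simp
  qed
  also have "\<dots> \<le> 1 + psi_real v"
    using psi_real_gap_bounds(2)[OF gap ab(1), of v] uvG by (simp add: G_def)
  finally have v0: "0 < 1 + psi_real v" .
  have "convex G"
  proof -
    have "G = {0<..} \<inter> {w. b * w > 1} \<inter> {w. a * w < 1}" by (auto simp: G_def mult.commute)
    also have "convex \<dots>"
      using convex_halfspace_gt[of 1 b] convex_halfspace_lt[of a 1]
      by (intro convex_Int) (auto simp: inner_real_def)
    finally show ?thesis .
  qed
  then have conn: "connected (psi_real ` G)"
    by (intro connected_continuous_image[OF cont] convex_connected)
  \<comment> \<open>\<open>psi_real v\<close> may be nonnegative; the minimum forces -1 < x < 0
    while x stays between the values at u and v.\<close>
  define x where "x = min (psi_real v) (- 1 / 2)"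
  have "x \<in> psi_real ` G"
    by (rule connectedD_interval[OF conn, of "psi_real u" "psi_real v"])
       (use uvG u0 v0 in \<open>auto simp: x_def min_def\<close>)
  then obtain w where w: "w \<in> G" "psi_real w = x" by auto
  have "x < 0" "1 + x > 0" using v0 by (auto simp: x_def min_def)
  then have "eta_real w < 0" using w by (simp add: eta_real_def divide_neg_pos)
  then show ?thesis using w G by (auto simp: G_def)
qed

section \<open>The subordination function and its functional equation\<close>

text \<open>If \<open>Sigma\<close> of \<open>\<nu>\<close> is the \<open>t\<close>-th power of \<open>Sigma\<close> of \<open>\<mu>\<close>, then eliminating \<open>Sigma\<close> from
  \<open>z = \<eta> Sigma(\<eta>)\<^sup>t\<close> and \<open>\<omega> = \<eta> Sigma(\<eta>)\<close>, where \<open>\<eta>\<close> is eta of \<open>\<nu>\<close> at \<open>z\<close>, leaves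
  \<open>(-\<omega>)\<^sup>t = (-\<eta>)\<^sup>t\<^sup>-\<^sup>1 (-z)\<close>; the signs select the principal branch on the slit plane.\<close>

definition subord :: "real \<Rightarrow> complex \<Rightarrow> complex" where
  "subord t z = - exp ((of_real (t - 1) * Ln (- eta \<nu> z) + Ln (- z)) / of_real t)"

text \<open>The exponent's imaginary part is a convex combination, with weights (t - 1)/t and 1/t,
  of two arguments in (-pi, pi), so its exponential avoids the branch cut.\<close>

lemma subord_in_slit_plane:
  assumes "z \<in> slit_plane" "t > 1"
  shows "subord t z \<in> slit_plane"
proof -
  define A B where "A = Im (Ln (- eta \<nu> z))" and "B = Im (Ln (- z))"
  define u where "u = (of_real (t - 1) * Ln (- eta \<nu> z) + Ln (- z)) / of_real t"
  have nonpos: "- z \<notin> \<real>\<^sub>\<le>\<^sub>0" "- eta \<nu> z \<notin> \<real>\<^sub>\<le>\<^sub>0"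
    using assms eta_in_slit_plane by (auto simp: slit_plane_iff_uminus)
  then have "- z \<noteq> 0" "- eta \<nu> z \<noteq> 0" by auto
  then have AB: "- pi < A" "A < pi" "- pi < B" "B < pi"
    using nonpos mpi_less_Im_Ln Im_Ln_less_pi unfolding A_def B_def by blast+
  have Im_u: "Im u = ((t - 1) * A + B) / t"
    using assms by (simp add: u_def A_def B_def)
  have "(t - 1) * A + B < (t - 1) * pi + pi" "(t - 1) * (- pi) - pi < (t - 1) * A + B"
    using AB assms by (intro add_le_less_mono mult_left_mono; simp)
      (use AB assms mult_left_mono[of "- pi" A "t - 1"] in simp)
  then have u: "- pi < Im u" "Im u < pi"
    using assms by (simp_all add: Im_u field_simps)
  have "exp u \<notin> \<real>\<^sub>\<le>\<^sub>0"
  proof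
    assume "exp u \<in> \<real>\<^sub>\<le>\<^sub>0"
    then have "Im (Ln (exp u)) = pi"
      using exp_not_eq_zero[of u]
      by (subst Im_Ln_eq_pi) (auto simp: complex_nonpos_Reals_iff less_le complex_eq_iff simp del: exp_not_eq_zero)
    then show False using u by simp
  qed
  then show ?thesis by (simp add: slit_plane_iff_uminus subord_def u_def)
qed

lemma subord_holomorphic: "t > 1 \<Longrightarrow> subord t holomorphic_on slit_plane"
  unfolding subord_def using eta_in_slit_plane
  by (intro holomorphic_intros eta_holomorphic) (auto simp: slit_plane_iff_uminus)

lemma eta_subord:
  assumes \<mu>: "nontrivial_law \<mu>" and t: "t > 1" and "\<epsilon> > 0"
    and Sigma: "\<And>x. - \<epsilon> < x \<Longrightarrow> x < 0 \<Longrightarrow> Sigma \<nu> x = Sigma \<mu> x powr t"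
    and "z \<in> slit_plane"
  shows "eta \<mu> (subord t z) = eta \<nu> z"
proof -
  interpret \<mu>: nontrivial_law \<mu> by (rule \<mu>)
  \<comment> \<open>For w close to 0, eta of \<open>\<nu>\<close> must lie both where the
    \<open>Sigma\<close> identity holds and in the range of eta of \<open>\<mu>\<close>.\<close>
  have "max (- \<epsilon>) (\<mu>.eta_real (- 1)) < 0"
    using \<open>\<epsilon> > 0\<close> \<mu>.eta_real_neg[of "-1"] by simp
  from order_tendstoD(1)[OF eta_real_tendsto_0 this]
  obtain d where d: "d < 0" "\<And>w. d < w \<Longrightarrow> w < 0 \<Longrightarrow> max (- \<epsilon>) (\<mu>.eta_real (- 1)) < eta_real w"
    by (auto simp: eventually_at_left_field)
  have eq: "eta \<mu> (subord t (of_real w)) = eta \<nu> (of_real w)" if w: "d < w" "w < 0" for w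
  proof -
    define x where "x = eta_real w"
    have x: "- \<epsilon> < x" "\<mu>.eta_real (- 1) < x" "x < 0"
      using d(2)[OF w] eta_real_neg w by (auto simp: x_def)
    obtain v where v: "v < 0" "\<mu>.eta_real v = x"
      using \<mu>.eta_real_surj_near_0[OF x(2,3)] by blast
    \<comment> \<open>The \<open>Sigma\<close> identity at the common value x of the two etas. Both
      ratios are positive, so logarithms solve it for v.\<close>
    have "w / x = (v / x) powr t"
      using Sigma[OF x(1,3)] Sigma_eta_real[OF w(2)] \<mu>.Sigma_eta_real[OF v(1)] v(2)
      by (simp add: x_def)
    then have "- w = - x * ((- v) / (- x)) powr t" using x by (simp add: field_simps)
    then have "ln (- w) = ln (- x * ((- v) / (- x)) powr t)" by simp
    also have "\<dots> = ln (- x) + t * ln ((- v) / (- x))"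
      using x v by (subst ln_mult) (simp_all add: ln_powr divide_neg_neg)
    also have "ln ((- v) / (- x)) = ln (- v) - ln (- x)"
      using x v by (subst ln_div) simp_all
    finally have "((t - 1) * ln (- x) + ln (- w)) / t = ln (- v)"
      using t by (simp add: field_simps)
    then have "exp (((t - 1) * ln (- x) + ln (- w)) / t) = - v" using v by simp
    moreover have "subord t (of_real w) = of_real (- exp (((t - 1) * ln (- x) + ln (- w)) / t))"
    proof -
      have Ln: "Ln (- of_real w) = of_real (ln (- w))" "Ln (- of_real x) = of_real (ln (- x))"
        using w x Ln_of_real[of "- w"] Ln_of_real[of "- x"] by simp_all
      show ?thesis
        unfolding subord_def eta_of_real x_def[symmetric] Ln
        by (simp only: of_real_minus of_real_mult of_real_divide of_real_add flip: exp_of_real)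
    qed
    ultimately have "subord t (of_real w) = of_real v" by simp
    then show ?thesis using v by (simp add: \<mu>.eta_of_real eta_of_real x_def)
  qed
  \<comment> \<open>The identity theorem extends the equation from the segment (d, 0), with limit
    point d/2.\<close>
  have "eta \<mu> (subord t z) - eta \<nu> z = 0"
  proof (rule analytic_continuation[where f = "\<lambda>z. eta \<mu> (subord t z) - eta \<nu> z", OF _ slit_plane_open slit_plane_connected])
    show "(\<lambda>z. eta \<mu> (subord t z) - eta \<nu> z) holomorphic_on slit_plane"
      using subord_in_slit_plane t
      by (intro holomorphic_intros eta_holomorphic
          holomorphic_on_compose_gen[OF subord_holomorphic \<mu>.eta_holomorphic, unfolded comp_def]) auto
    show "complex_of_real ` {d<..<0} \<subseteq> slit_plane" by (auto simp: of_real_in_slit_plane)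
    show "complex_of_real (d / 2) \<in> slit_plane" using d(1) by (simp add: of_real_in_slit_plane del: of_real_divide)
    show "complex_of_real (d / 2) islimpt complex_of_real ` {d<..<0}"
      unfolding islimpt_approachable
    proof (intro allI impI)
      fix e :: real assume "e > 0"
      \<comment> \<open>The cap \<open>- d / 4\<close> keeps y at most d/4, hence negative.\<close>
      define y where "y = d / 2 + min (e / 2) (- d / 4)"
      have "y \<in> {d<..<0}" "y \<noteq> d / 2" "\<bar>y - d / 2\<bar> < e"
        using d(1) \<open>e > 0\<close> by (auto simp: y_def min_def)
      then show "\<exists>x'\<in>complex_of_real ` {d<..<0}. x' \<noteq> complex_of_real (d / 2) \<and> dist x' (complex_of_real (d / 2)) < e"
        by (intro bexI[of _ "of_real y"]) (auto simp: dist_of_real dist_real_def simp del: of_real_divide)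
    qed
    show "z \<in> slit_plane" by fact
  qed (auto simp: eq)
  then show ?thesis by simp
qed

end

section \<open>Boundary values of the subordination function at a point of the gap\<close>

theorem theorem2p5:
  fixes \<mu> \<mu>t :: "real measure" and t a b :: real
  assumes "prob_on_nonneg \<mu>" and "not_delta0 \<mu>"
    and "t > 1"
    and "prob_on_nonneg \<mu>t" and "not_delta0 \<mu>t"
    and "\<exists>\<epsilon>>0. \<forall>z. -\<epsilon> < z \<and> z < 0 \<longrightarrow> Sigma \<mu>t z = Sigma \<mu> z powr t"
    and "0 \<le> a" and "a < b"
    and "measure \<mu>t {a} > 0" and "measure \<mu>t {b} > 0"
  shows "measure \<mu>t {a<..<b} > 0"
proof (rule ccontr)
  interpret \<mu>: nontrivial_law \<mu> using assms by (intro nontrivial_lawI)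
  interpret \<mu>t: nontrivial_law \<mu>t using assms by (intro nontrivial_lawI)
  assume "\<not> measure \<mu>t {a<..<b} > 0"
  then have "measure \<mu>t {a<..<b} = 0" by (simp add: zero_less_measure_iff)
  then have "AE s in \<mu>t. s \<notin> {a<..<b}"
    by (subst \<mu>t.prob_eq_0[symmetric]) (auto simp: \<mu>t.sets_borel)
  then have "AE s in \<mu>t. s \<le> a \<or> b \<le> s" by eventually_elim auto
  then obtain w K where w: "w > 0" "\<mu>t.admissible K (of_real w)" "\<mu>t.eta_real w < 0"
    using \<mu>t.eta_real_neg_in_gap assms by blast
  obtain \<epsilon> where \<epsilon>: "\<epsilon> > 0" "\<And>x. - \<epsilon> < x \<Longrightarrow> x < 0 \<Longrightarrow> Sigma \<mu>t x = Sigma \<mu> x powr t"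
    using assms(6) by blast
  define X where "X n = Complex w (1 / real (Suc n))" for n
  have X_slit: "X n \<in> slit_plane" for n by (simp add: X_def slit_plane_iff)
  have X: "X \<longlonglongrightarrow> of_real w"
    unfolding tendsto_complex_iff X_def using LIMSEQ_Suc[OF lim_1_over_n] by simp
  \<comment> \<open>A zero denominator would make \<open>eta_real w\<close> equal to 0,
    contradicting its sign.\<close>
  have nz: "1 + psi \<mu>t (of_real w) \<noteq> 0"
    using w(3) unfolding \<mu>t.eta_real_def \<mu>t.psi_of_real
    by (metis division_ring_divide_zero less_irrefl of_real_1 of_real_add of_real_eq_0_iff)
  have "isCont (eta \<mu>t) (of_real w)"
    unfolding eta_def by (intro continuous_intros \<mu>t.isCont_psi[OF w(2)] nz)
  then have eta_lim: "(\<lambda>n. eta \<mu>t (X n)) \<longlonglongrightarrow> of_real (\<mu>t.eta_real w)"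
    using isCont_tendsto_compose[OF _ X] \<mu>t.eta_of_real by metis
  define x where "x = \<mu>t.eta_real w"
  define \<omega> where "\<omega> = - exp ((of_real (t - 1) * Ln (- of_real x) + (Ln (of_real w) - \<i> * pi)) / of_real t)"
  \<comment> \<open>The limit of \<open>- X n\<close> lies on the branch cut of \<open>Ln\<close>.
    This shift, valid in the upper half plane, rewrites the logarithm so that it is continuous at
    w.\<close>
  have Ln_X: "Ln (- X n) = Ln (X n) - \<i> * pi" for n
    by (subst Ln_minus) (auto simp: X_def complex_eq_iff)
  have lim_\<omega>: "(\<lambda>n. \<mu>t.subord t (X n)) \<longlonglongrightarrow> \<omega>"
    unfolding \<mu>t.subord_def \<omega>_def Ln_X x_def
    using w assms(3) by (intro tendsto_intros eta_lim X) (auto simp: complex_nonpos_Reals_iff)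
  \<comment> \<open>The exponent has imaginary part -pi/t, and the outer minus sign turns this into
    the argument pi - pi/t, strictly between 0 and pi since t > 1.\<close>
  have Im_\<omega>: "Im \<omega> > 0"
  proof -
    have "Ln (- of_real x) = of_real (ln (- x))" "Ln (of_real w) = of_real (ln w)"
      using w Ln_of_real[of "- x"] Ln_of_real[of w] by (simp_all add: x_def)
    then have "Im \<omega> = exp (((t - 1) * ln (- x) + ln w) / t) * sin (pi / t)"
      using assms(3) by (simp add: \<omega>_def Im_exp Re_divide_of_real Im_divide_of_real)
    moreover have "sin (pi / t) > 0"
      using assms(3) by (intro sin_gt_zero) (auto simp: divide_less_eq)
    ultimately show ?thesis by simp
  qed
  have "isCont (eta \<mu>) \<omega>"
    using \<mu>.eta_holomorphic slit_plane_open Im_\<omega>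
    by (intro continuous_on_interior[OF holomorphic_on_imp_continuous_on])
       (auto simp: interior_open slit_plane_iff)
  then have "(\<lambda>n. eta \<mu> (\<mu>t.subord t (X n))) \<longlonglongrightarrow> eta \<mu> \<omega>"
    using lim_\<omega> by (rule isCont_tendsto_compose)
  then have "(\<lambda>n. eta \<mu>t (X n)) \<longlonglongrightarrow> eta \<mu> \<omega>"
    using \<mu>t.eta_subord[OF \<mu>.nontrivial_law_axioms assms(3) \<epsilon> X_slit] by simp
  then have "eta \<mu> \<omega> = of_real (\<mu>t.eta_real w)"
    using eta_lim by (rule LIMSEQ_unique)
  then show False using \<mu>.Im_eta_sign[of \<omega>] Im_\<omega> by auto
qed

end
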